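(* Let $(M,J,g,G)$ be an almost anti-Hermitian manifold and let $\nabla$ be a $J$-invariant torsion-free linear connection on $M$. Let $\nabla^{\dagger}$ and $\nabla^{\ast}$ denote respectively the $G$-conjugate and the $g$-conjugate connections of $\nabla$. If $(\nabla,G)$ is a statistical structure, then the following statements hold: i) $(\nabla^{\dagger},g)$ is a statistical structure; ii) $(\nabla,g)$ is a statistical structure; iii) $(\nabla^{\ast},g)$ is a statistical structure. Conversely, if any one of the statements i)–iii) is satisfied, then $(\nabla,G)$ is a statistical structure.
   Context: An almost anti-Hermitian manifold $(M,J,g,G)$ is a smooth $2n$-dimensional manifold $M$ with an almost complex structure $J$ ($J^{2}=-\mathrm{id}$), a pseudo-Riemannian metric $g$ of neutral signature $(n,n)$ satisfying $g(JX,JY)=-g(X,Y)$, equivalently $g(JX,Y)=g(X,JY)$, for all vector fields $X,Y$, and the twin metric $G(X,Y)=g(JX,Y)$ (which is again a pseudo-Riemannian metric). A linear connection is a connection on $TM$. It is $J$-invariant if $\nabla_X(JY)=J\nabla_X Y$ for all vector fields $X,Y$. The conjugates $\nabla^{\ast}$ and $\nabla^{\dagger}$ are the linear connections determined by $$Zg(X,Y)=g(\nabla_Z X,Y)+g(X,\nabla^{\ast}_Z Y),\qquad ZG(X,Y)=G(\nabla_Z X,Y)+G(X,\nabla^{\dagger}_Z Y)$$ for all vector fields $X,Y,Z$. For a linear connection $D$ and a pseudo-Riemannian metric $h$, $(D,h)$ is a Codazzi pair if $(D_Z h)(X,Y)=(D_X h)(Z,Y)$ for all vector fields $X,Y,Z$;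 $(D,h)$ is a statistical structure if $D$ is torsion-free and $(D,h)$ is a Codazzi pair. *)

theory Defs
  imports "HOL-Analysis.Analysis" "HOL-Library.Function_Algebras"
begin

section \<open>Smooth manifolds\<close>

(* C^k on an open set S: f is differentiable on S and all directional derivatives are C^(k-1).
   The domain is finite-dimensional, so this is the usual notion. Only used for open S. *)
primrec Ck_on ::
    "nat \<Rightarrow> 'e::euclidean_space set \<Rightarrow> ('e \<Rightarrow> 'f::real_normed_vector) \<Rightarrow> bool" where
  "Ck_on 0 S f = continuous_on S f"
| "Ck_on (Suc k) S f =
     ((\<forall>x\<in>S. f differentiable (at x)) \<and>
      (\<forall>u. Ck_on k S (\<lambda>x. frechet_derivative f (at x) u)))"

definition smooth_on :: "'e::euclidean_space set \<Rightarrow> ('e \<Rightarrow> 'f::real_normed_vector) \<Rightarrow> bool" where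
  "smooth_on S f \<longleftrightarrow> (\<forall>k. Ck_on k S f)"

(* The underlying space of the manifold is the whole type 'm, the model space is 'e.
   A chart is a pair of its domain U and a map phi that is only relevant on U. *)
type_synonym ('m, 'e) atlas = "('m set \<times> ('m \<Rightarrow> 'e)) set"

definition smooth_atlas ::
    "('m::{t2_space,second_countable_topology}, 'e::euclidean_space) atlas \<Rightarrow> bool" where
  "smooth_atlas A \<longleftrightarrow>
     (\<Union>(U, \<phi>)\<in>A. U) = UNIV \<and>
     (\<forall>(U, \<phi>)\<in>A. open U \<and> open (\<phi> ` U) \<and> homeomorphism U (\<phi> ` U) \<phi> (inv_into U \<phi>)) \<and>
     (\<forall>(U, \<phi>)\<in>A. \<forall>(V, \<psi>)\<in>A. smooth_on (\<phi> ` (U \<inter> V)) (\<psi> \<circ> inv_into U \<phi>))"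

definition smooth_fun :: "('m, 'e::euclidean_space) atlas \<Rightarrow> ('m \<Rightarrow> real) \<Rightarrow> bool" where
  "smooth_fun A f \<longleftrightarrow> (\<forall>(U, \<phi>)\<in>A. smooth_on (\<phi> ` U) (f \<circ> inv_into U \<phi>))"


section \<open>Tangent vectors and vector fields\<close>

type_synonym 'm tvec = "('m \<Rightarrow> real) \<Rightarrow> real"
type_synonym 'm vfield = "'m \<Rightarrow> 'm tvec"

definition scale_tvec :: "real \<Rightarrow> 'm tvec \<Rightarrow> 'm tvec" where
  "scale_tvec c v = (\<lambda>f. c * v f)"

(* Derivations at p of the algebra of smooth functions. Sums and products of functions, of
   tangent vectors and of fields are pointwise. The last clause fixes the junk values off the
   smooth functions, so that equality of tangent vectors in HOL is equality of derivations. *)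
definition tangent_space ::
    "('m, 'e::euclidean_space) atlas \<Rightarrow> 'm \<Rightarrow> 'm tvec set" where
  "tangent_space A p = {v.
     (\<forall>f g. smooth_fun A f \<longrightarrow> smooth_fun A g \<longrightarrow> v (f + g) = v f + v g) \<and>
     (\<forall>c f. smooth_fun A f \<longrightarrow> v (\<lambda>q. c * f q) = c * v f) \<and>
     (\<forall>f g. smooth_fun A f \<longrightarrow> smooth_fun A g \<longrightarrow> v (f * g) = v f * g p + f p * v g) \<and>
     (\<forall>f. \<not> smooth_fun A f \<longrightarrow> v f = 0)}"

definition vf_apply :: "'m vfield \<Rightarrow> ('m \<Rightarrow> real) \<Rightarrow> 'm \<Rightarrow> real" where
  "vf_apply X f = (\<lambda>p. X p f)"

definition vector_fields :: "('m, 'e::euclidean_space) atlas \<Rightarrow> 'm vfield set" where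
  "vector_fields A = {X.
     (\<forall>p. X p \<in> tangent_space A p) \<and> (\<forall>f. smooth_fun A f \<longrightarrow> smooth_fun A (vf_apply X f))}"

definition scale_vf :: "('m \<Rightarrow> real) \<Rightarrow> 'm vfield \<Rightarrow> 'm vfield" where
  "scale_vf f X = (\<lambda>p. scale_tvec (f p) (X p))"

definition lie_bracket :: "'m vfield \<Rightarrow> 'm vfield \<Rightarrow> 'm vfield" where
  "lie_bracket X Y = (\<lambda>p f. X p (vf_apply Y f) - Y p (vf_apply X f))"


section \<open>Tensor fields\<close>

type_synonym 'm endo_field = "'m \<Rightarrow> 'm tvec \<Rightarrow> 'm tvec"
type_synonym 'm bilin_field = "'m \<Rightarrow> 'm tvec \<Rightarrow> 'm tvec \<Rightarrow> real"

definition endo_app :: "'m endo_field \<Rightarrow> 'm vfield \<Rightarrow> 'm vfield" where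
  "endo_app J X = (\<lambda>p. J p (X p))"

definition bilin_app :: "'m bilin_field \<Rightarrow> 'm vfield \<Rightarrow> 'm vfield \<Rightarrow> 'm \<Rightarrow> real" where
  "bilin_app h X Y = (\<lambda>p. h p (X p) (Y p))"

definition almost_complex_structure ::
    "('m, 'e::euclidean_space) atlas \<Rightarrow> 'm endo_field \<Rightarrow> bool" where
  "almost_complex_structure A J \<longleftrightarrow>
     (\<forall>p. \<forall>v\<in>tangent_space A p. J p v \<in> tangent_space A p) \<and>
     (\<forall>p. \<forall>v\<in>tangent_space A p. \<forall>w\<in>tangent_space A p. J p (v + w) = J p v + J p w) \<and>
     (\<forall>p c. \<forall>v\<in>tangent_space A p. J p (scale_tvec c v) = scale_tvec c (J p v)) \<and>
     (\<forall>X\<in>vector_fields A. endo_app J X \<in> vector_fields A) \<and>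
     (\<forall>p. \<forall>v\<in>tangent_space A p. J p (J p v) = scale_tvec (- 1) v)"

definition pseudo_riemannian_metric ::
    "('m, 'e::euclidean_space) atlas \<Rightarrow> 'm bilin_field \<Rightarrow> bool" where
  "pseudo_riemannian_metric A h \<longleftrightarrow>
     (\<forall>p. \<forall>v\<in>tangent_space A p. \<forall>w\<in>tangent_space A p. h p v w = h p w v) \<and>
     (\<forall>p. \<forall>u\<in>tangent_space A p. \<forall>v\<in>tangent_space A p. \<forall>w\<in>tangent_space A p.
        h p (u + v) w = h p u w + h p v w) \<and>
     (\<forall>p c. \<forall>v\<in>tangent_space A p. \<forall>w\<in>tangent_space A p.
        h p (scale_tvec c v) w = c * h p v w) \<and>
     (\<forall>X\<in>vector_fields A. \<forall>Y\<in>vector_fields A. smooth_fun A (bilin_app h X Y)) \<and>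
     (\<forall>p. \<forall>v\<in>tangent_space A p. (\<forall>w\<in>tangent_space A p. h p v w = 0) \<longrightarrow> v = 0)"

(* Signature (r, s) at p: the tangent space has a pseudo-orthonormal basis with r vectors of
   square +1 and s of square -1; linear independence is a consequence of the orthogonality. *)
definition signature_at ::
    "('m, 'e::euclidean_space) atlas \<Rightarrow> 'm bilin_field \<Rightarrow> 'm \<Rightarrow> nat \<Rightarrow> nat \<Rightarrow> bool" where
  "signature_at A h p r s \<longleftrightarrow> (\<exists>e :: nat \<Rightarrow> 'm tvec.
     (\<forall>i<r + s. e i \<in> tangent_space A p) \<and>
     (\<forall>v\<in>tangent_space A p. \<exists>c. v = (\<Sum>i<r + s. scale_tvec (c i) (e i))) \<and>
     (\<forall>i<r + s. \<forall>j<r + s.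
        h p (e i) (e j) = (if i \<noteq> j then 0 else if i < r then 1 else - 1)))"

definition twin_metric :: "'m endo_field \<Rightarrow> 'm bilin_field \<Rightarrow> 'm bilin_field" where
  "twin_metric J g = (\<lambda>p v w. g p (J p v) w)"

definition almost_anti_hermitian ::
    "nat \<Rightarrow> ('m::{t2_space,second_countable_topology}, 'e::euclidean_space) atlas \<Rightarrow>
     'm endo_field \<Rightarrow> 'm bilin_field \<Rightarrow> 'm bilin_field \<Rightarrow> bool" where
  "almost_anti_hermitian n A J g G \<longleftrightarrow>
     smooth_atlas A \<and> DIM('e) = 2 * n \<and>
     almost_complex_structure A J \<and>
     pseudo_riemannian_metric A g \<and> (\<forall>p. signature_at A g p n n) \<and>
     (\<forall>X\<in>vector_fields A. \<forall>Y\<in>vector_fields A.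
        bilin_app g (endo_app J X) (endo_app J Y) = - bilin_app g X Y) \<and>
     G = twin_metric J g"


section \<open>Linear connections\<close>

type_synonym 'm connection = "'m vfield \<Rightarrow> 'm vfield \<Rightarrow> 'm vfield"

definition linear_connection ::
    "('m, 'e::euclidean_space) atlas \<Rightarrow> 'm connection \<Rightarrow> bool" where
  "linear_connection A D \<longleftrightarrow>
     (\<forall>X\<in>vector_fields A. \<forall>Y\<in>vector_fields A. D X Y \<in> vector_fields A) \<and>
     (\<forall>X\<in>vector_fields A. \<forall>Y\<in>vector_fields A. \<forall>Z\<in>vector_fields A.
        D (X + Y) Z = D X Z + D Y Z \<and> D Z (X + Y) = D Z X + D Z Y) \<and>
     (\<forall>f. \<forall>X\<in>vector_fields A. \<forall>Y\<in>vector_fields A. smooth_fun A f \<longrightarrow>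
        D (scale_vf f X) Y = scale_vf f (D X Y) \<and>
        D X (scale_vf f Y) = scale_vf (vf_apply X f) Y + scale_vf f (D X Y))"

definition J_invariant ::
    "('m, 'e::euclidean_space) atlas \<Rightarrow> 'm endo_field \<Rightarrow> 'm connection \<Rightarrow> bool" where
  "J_invariant A J D \<longleftrightarrow>
     (\<forall>X\<in>vector_fields A. \<forall>Y\<in>vector_fields A. D X (endo_app J Y) = endo_app J (D X Y))"

definition torsion_free ::
    "('m, 'e::euclidean_space) atlas \<Rightarrow> 'm connection \<Rightarrow> bool" where
  "torsion_free A D \<longleftrightarrow>
     (\<forall>X\<in>vector_fields A. \<forall>Y\<in>vector_fields A. D X Y - D Y X = lie_bracket X Y)"

definition conjugate_connection ::
    "('m, 'e::euclidean_space) atlas \<Rightarrow> 'm bilin_field \<Rightarrow> 'm connection \<Rightarrow> 'm connection \<Rightarrow> bool" where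
  "conjugate_connection A h D D' \<longleftrightarrow>
     linear_connection A D' \<and>
     (\<forall>X\<in>vector_fields A. \<forall>Y\<in>vector_fields A. \<forall>Z\<in>vector_fields A.
        vf_apply Z (bilin_app h X Y) = bilin_app h (D Z X) Y + bilin_app h X (D' Z Y))"

definition cov_deriv_metric ::
    "'m connection \<Rightarrow> 'm bilin_field \<Rightarrow> 'm vfield \<Rightarrow> 'm vfield \<Rightarrow> 'm vfield \<Rightarrow> 'm \<Rightarrow> real" where
  "cov_deriv_metric D h Z X Y =
     vf_apply Z (bilin_app h X Y) - bilin_app h (D Z X) Y - bilin_app h X (D Z Y)"

definition codazzi_pair ::
    "('m, 'e::euclidean_space) atlas \<Rightarrow> 'm connection \<Rightarrow> 'm bilin_field \<Rightarrow> bool" where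
  "codazzi_pair A D h \<longleftrightarrow>
     (\<forall>X\<in>vector_fields A. \<forall>Y\<in>vector_fields A. \<forall>Z\<in>vector_fields A.
        cov_deriv_metric D h Z X Y = cov_deriv_metric D h X Z Y)"

definition statistical_structure ::
    "('m, 'e::euclidean_space) atlas \<Rightarrow> 'm connection \<Rightarrow> 'm bilin_field \<Rightarrow> bool" where
  "statistical_structure A D h \<longleftrightarrow> torsion_free A D \<and> codazzi_pair A D h"

end

theory Submission
  imports Defs
begin

text \<open>
All four statistical structures amount to one condition, that \<^term>\<open>(D, g)\<close> is a Codazzi pair.
Write \<^term>\<open>C h Z X Y\<close> for the covariant derivative of a metric \<^term>\<open>h\<close> along \<^term>\<open>Z\<close>.

Since \<^term>\<open>J\<close> commutes with \<^term>\<open>D\<close> and is self-adjoint for \<^term>\<open>g\<close>, the derivatives of the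
two metrics satisfy \<^term>\<open>C G Z X Y = C g Z X (J Y)\<close>. The Codazzi condition does not move the last
argument, and \<^term>\<open>J\<close> is invertible, so it holds for \<^term>\<open>G\<close> exactly if it holds for
\<^term>\<open>g\<close> (\<open>codazzi_twin_iff\<close>). For the same reason the conjugate of \<^term>\<open>D\<close> with respect to
\<^term>\<open>G\<close> is also its conjugate with respect to \<^term>\<open>g\<close> (\<open>conjugate_twin_imp_conjugate\<close>), which
makes the statements about the two conjugates one and the same.

For the conjugate \<^term>\<open>D'\<close> of \<^term>\<open>D\<close> with respect to \<^term>\<open>g\<close>,
\<^term>\<open>C g Z X Y = g X (D' Z Y - D Z Y)\<close>. Passing from \<^term>\<open>D\<close> to \<^term>\<open>D'\<close> changes the sign
of the left-hand side, hence preserves the Codazzi condition (\<open>codazzi_conjugate_iff\<close>). If the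
condition holds, the left-hand side is totally symmetric, so \<^term>\<open>D' Z Y - D Z Y\<close> is symmetric in
\<^term>\<open>Y\<close> and \<^term>\<open>Z\<close> by nondegeneracy of \<^term>\<open>g\<close>, and \<^term>\<open>D'\<close> is torsion-free along with
\<^term>\<open>D\<close> (\<open>torsion_free_conjugate\<close>).

This last step is the only one that is not algebra. Connections see vector fields on the whole
manifold, whereas nondegeneracy quantifies over the derivations at a point, so every derivation at
a point has to be the value of a vector field (\<open>tangent_vector_extends\<close>). A smooth bump function
cuts the coordinate fields of a chart off to global fields whose values at the point are linearly
independent. That they span needs no description of derivations in coordinates: the signature of
the metric already bounds the dimension of the tangent space by that of the model space.\<close>


section \<open>Calculus of smooth maps between Euclidean spaces\<close>

lemma Ck_on_cong:
  assumes "open S" "\<And>x. x \<in> S \<Longrightarrow> f x = g x" "Ck_on k S f"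
  shows "Ck_on k S g"
  using assms(2,3)
proof (induction k arbitrary: f g)
  case 0
  then show ?case by (simp cong: continuous_on_cong)
next
  case (Suc k)
  have g: "(g has_derivative frechet_derivative f (at x)) (at x)" if "x \<in> S" for x
  proof (rule has_derivative_transform_within_open[OF _ assms(1) that])
    show "(f has_derivative frechet_derivative f (at x)) (at x)"
      using Suc.prems(2) that frechet_derivative_works by auto
  qed (rule Suc.prems(1))
  have "Ck_on k S (\<lambda>x. frechet_derivative g (at x) u)" for u
    by (rule Suc.IH[of "\<lambda>x. frechet_derivative f (at x) u"])
      (use Suc.prems(2) frechet_derivative_at[OF g] in auto)
  then show ?case
    using g by (auto simp: differentiable_def)
qed

lemma Ck_on_Suc:
  assumes "open S" "\<And>x. x \<in> S \<Longrightarrow> (f has_derivative f' x) (at x)"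
    and "\<And>u. Ck_on k S (\<lambda>x. f' x u)"
  shows "Ck_on (Suc k) S f"
proof -
  have "Ck_on k S (\<lambda>x. frechet_derivative f (at x) u)" for u
    by (rule Ck_on_cong[OF assms(1) _ assms(3)[of u]])
      (simp add: frechet_derivative_at[OF assms(2), symmetric])
  then show ?thesis
    using assms(2) by (auto simp: differentiable_def)
qed

lemma Ck_on_has_derivative:
  assumes "Ck_on (Suc k) S f" "x \<in> S"
  shows "(f has_derivative frechet_derivative f (at x)) (at x)"
  using assms frechet_derivative_works by auto

lemma Ck_on_lower:
  assumes "Ck_on (Suc k) S f"
  shows "Ck_on k S f"
  using assms
proof (induction k arbitrary: f)
  case 0
  then show ?case
    by (auto intro!: continuous_at_imp_continuous_on differentiable_imp_continuous_within)
qed auto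

lemma Ck_on_subset:
  assumes "Ck_on k S f" "T \<subseteq> S"
  shows "Ck_on k T f"
  using assms by (induction k arbitrary: f) (auto intro: continuous_on_subset)

lemma Ck_on_Un:
  assumes "open S" "open T" "Ck_on k S f" "Ck_on k T f"
  shows "Ck_on k (S \<union> T) f"
  using assms(3,4)
  by (induction k arbitrary: f) (simp_all add: continuous_on_open_Un assms(1,2) ball_Un)

lemma Ck_on_const:
  assumes "open S"
  shows "Ck_on k S (\<lambda>x. c)"
proof (induction k arbitrary: c)
  case (Suc k)
  show ?case
    by (rule Ck_on_Suc[OF assms, where f' = "\<lambda>_ _. 0"]) (auto intro: Suc)
qed simp

lemma Ck_on_bounded_linear:
  assumes "open S" "bounded_linear L" "Ck_on k S f"
  shows "Ck_on k S (\<lambda>x. L (f x))"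
  using assms(3)
proof (induction k arbitrary: f)
  case 0
  then show ?case
    using bounded_linear.continuous_on[OF assms(2)] by simp
next
  case (Suc k)
  show ?case
    by (rule Ck_on_Suc[OF assms(1), where f' = "\<lambda>x u. L (frechet_derivative f (at x) u)"])
      (use Suc.prems in \<open>simp_all add: Suc.IH bounded_linear.has_derivative[OF assms(2)]
        Ck_on_has_derivative del: Ck_on.simps, simp add: Suc.IH\<close>)
qed

lemma Ck_on_id:
  assumes "open S"
  shows "Ck_on k S (\<lambda>x. x)"
proof (cases k)
  case (Suc l)
  show ?thesis unfolding Suc
    by (rule Ck_on_Suc[OF assms, where f' = "\<lambda>x u. u"])
      (auto intro: Ck_on_const[OF assms])
qed auto

lemma Ck_on_add:
  assumes "open S" "Ck_on k S f" "Ck_on k S g"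
  shows "Ck_on k S (\<lambda>x. f x + g x)"
  using assms(2,3)
proof (induction k arbitrary: f g)
  case 0
  then show ?case by (auto intro: continuous_on_add)
next
  case (Suc k)
  show ?case
    by (rule Ck_on_Suc[OF assms(1), where f' = "\<lambda>x u. frechet_derivative f (at x) u
          + frechet_derivative g (at x) u"])
      (use Suc.prems in \<open>simp_all add: has_derivative_add Ck_on_has_derivative del: Ck_on.simps,
        simp add: Suc.IH\<close>)
qed

lemma Ck_on_sum:
  assumes "open S" "\<And>i. i \<in> I \<Longrightarrow> Ck_on k S (f i)"
  shows "Ck_on k S (\<lambda>x. \<Sum>i\<in>I. f i x)"
  using assms(2)
  by (induction I rule: infinite_finite_induct)
    (simp_all add: Ck_on_const Ck_on_add assms(1))

lemma Ck_on_bounded_bilinear: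
  assumes "open S" "bounded_bilinear B" "Ck_on k S f" "Ck_on k S g"
  shows "Ck_on k S (\<lambda>x. B (f x) (g x))"
  using assms(3,4)
proof (induction k arbitrary: f g)
  case 0
  then show ?case
    using bounded_bilinear.continuous_on[OF assms(2)] by simp
next
  case (Suc k)
  show ?case
    by (rule Ck_on_Suc[OF assms(1), where f' = "\<lambda>x u. B (f x) (frechet_derivative g (at x) u)
          + B (frechet_derivative f (at x) u) (g x)"])
      (use Suc.prems Suc.prems[THEN Ck_on_lower] in \<open>simp_all add:
        bounded_bilinear.FDERIV[OF assms(2)] Ck_on_has_derivative del: Ck_on.simps,
        simp add: Suc.IH Ck_on_add[OF assms(1)]\<close>)
qed

text \<open>The derivative of \<^term>\<open>f \<circ> g\<close> in direction \<^term>\<open>u\<close> is the derivative of \<^term>\<open>f\<close> in a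
  direction that varies with the point. Expanding that direction in the standard basis turns it
  into a sum of products of functions to which the induction hypothesis applies.\<close>

lemma Ck_on_compose:
  fixes g :: "'a::euclidean_space \<Rightarrow> 'b::euclidean_space"
  assumes "open S" "open T" "g ` S \<subseteq> T" "Ck_on k S g" "Ck_on k T f"
  shows "Ck_on k S (f \<circ> g)"
  using assms(4,5)
proof (induction k arbitrary: f)
  case 0
  then have "continuous_on S g" "continuous_on (g ` S) f"
    using continuous_on_subset[OF _ assms(3)] by simp_all
  then show ?case
    by (simp only: Ck_on.simps continuous_on_compose)
next
  case (Suc k)
  let ?Df = "\<lambda>y. frechet_derivative f (at y)" and ?Dg = "\<lambda>x. frechet_derivative g (at x)"
  have "(f \<circ> g has_derivative (\<lambda>u. \<Sum>b\<in>Basis. (?Dg x u \<bullet> b) *\<^sub>R ?Df (g x) b)) (at x)"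
    if x: "x \<in> S" for x
  proof -
    have Df: "(f has_derivative ?Df (g x)) (at (g x))"
      using Ck_on_has_derivative Suc.prems(2) x assms(3) by blast
    then have lin: "linear (?Df (g x))"
      by (rule has_derivative_linear)
    have "(?Df (g x) \<circ> ?Dg x) u = (\<Sum>b\<in>Basis. (?Dg x u \<bullet> b) *\<^sub>R ?Df (g x) b)" for u
    proof -
      have "(?Df (g x) \<circ> ?Dg x) u = ?Df (g x) (\<Sum>b\<in>Basis. (?Dg x u \<bullet> b) *\<^sub>R b)"
        by (simp only: euclidean_representation o_apply)
      also have "\<dots> = (\<Sum>b\<in>Basis. (?Dg x u \<bullet> b) *\<^sub>R ?Df (g x) b)"
        by (simp only: linear_sum[OF lin] linear_cmul[OF lin])
      finally show ?thesis .
    qed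
    then have "?Df (g x) \<circ> ?Dg x = (\<lambda>u. \<Sum>b\<in>Basis. (?Dg x u \<bullet> b) *\<^sub>R ?Df (g x) b)" ..
    then show ?thesis
      using diff_chain_at[OF Ck_on_has_derivative[OF Suc.prems(1) x] Df] by (simp only:)
  qed
  moreover have "Ck_on k S (\<lambda>x. \<Sum>b\<in>Basis. (?Dg x u \<bullet> b) *\<^sub>R ?Df (g x) b)" for u
  proof (rule Ck_on_sum[OF assms(1)])
    fix b :: 'b assume "b \<in> Basis"
    have "Ck_on k S (\<lambda>x. ?Dg x u \<bullet> b)"
      by (rule Ck_on_bounded_linear[OF assms(1) bounded_linear_inner_left])
        (use Suc.prems(1) in simp)
    moreover have "Ck_on k S ((\<lambda>y. ?Df y b) \<circ> g)"
      by (rule Suc.IH[OF Ck_on_lower[OF Suc.prems(1)]]) (use Suc.prems(2) in simp)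
    ultimately show "Ck_on k S (\<lambda>x. (?Dg x u \<bullet> b) *\<^sub>R ?Df (g x) b)"
      unfolding o_def by (rule Ck_on_bounded_bilinear[OF assms(1) bounded_bilinear_scaleR])
  qed
  ultimately show ?case by (rule Ck_on_Suc[OF assms(1)])
qed

lemma smooth_on_differentiable:
  assumes "smooth_on S f" "x \<in> S"
  shows "(f has_derivative frechet_derivative f (at x)) (at x)"
  using assms Ck_on_has_derivative smooth_on_def by blast

lemma smooth_on_derivative:
  assumes "smooth_on S f"
  shows "smooth_on S (\<lambda>x. frechet_derivative f (at x) u)"
  using assms Ck_on.simps(2) unfolding smooth_on_def by blast

lemma smooth_on_cong:
  assumes "open S" "\<And>x. x \<in> S \<Longrightarrow> f x = g x" "smooth_on S f"
  shows "smooth_on S g"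
  using assms Ck_on_cong unfolding smooth_on_def by blast

lemma smooth_on_const: "open S \<Longrightarrow> smooth_on S (\<lambda>x. c)"
  by (simp add: smooth_on_def Ck_on_const)

lemma smooth_on_add:
  assumes "open S" "smooth_on S f" "smooth_on S g"
  shows "smooth_on S (\<lambda>x. f x + g x)"
  using assms Ck_on_add unfolding smooth_on_def by blast

lemma smooth_on_mult:
  fixes f g :: "_ \<Rightarrow> real"
  assumes "open S" "smooth_on S f" "smooth_on S g"
  shows "smooth_on S (\<lambda>x. f x * g x)"
  using assms Ck_on_bounded_bilinear[OF _ bounded_bilinear_mult] unfolding smooth_on_def by blast

lemma smooth_on_compose:
  fixes g :: "'a::euclidean_space \<Rightarrow> 'b::euclidean_space"
  assumes "open S" "open T" "g ` S \<subseteq> T" "smooth_on S g" "smooth_on T f"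
  shows "smooth_on S (f \<circ> g)"
  using assms Ck_on_compose unfolding smooth_on_def by blast


section \<open>A smooth bump function\<close>

text \<open>The powers of \<^term>\<open>1 / t\<close> are there for the induction that shows smoothness: the
  derivatives of the case \<^term>\<open>n = 0\<close> are linear combinations of the other cases.\<close>

definition flat_fun :: "nat \<Rightarrow> real \<Rightarrow> real" where
  "flat_fun n t = (if t > 0 then inverse t ^ n * exp (- inverse t) else 0)"

lemma flat_fun_tendsto_0: "(flat_fun n \<longlongrightarrow> 0) (at 0)"
proof -
  have "((\<lambda>t. inverse t ^ n / exp (inverse t)) \<longlongrightarrow> (0::real)) (at_right 0)"
    using tendsto_power_div_exp_0 filterlim_inverse_at_top_right by (rule filterlim_compose)
  then have "(flat_fun n \<longlongrightarrow> 0) (at_right 0)"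
    by (rule Lim_transform_eventually)
      (auto simp: flat_fun_def eventually_at_filter exp_minus divide_inverse)
  moreover have "(flat_fun n \<longlongrightarrow> 0) (at_left 0)"
    by (rule Lim_transform_eventually[OF tendsto_const])
      (auto simp: flat_fun_def eventually_at_filter)
  ultimately show ?thesis by (simp add: filterlim_split_at_real)
qed

lemma flat_fun_has_derivative:
  "(flat_fun n has_real_derivative flat_fun (n + 2) t - real n * flat_fun (n + 1) t) (at t)"
proof -
  consider "t > 0" | "t < 0" | "t = 0" by linarith
  then show ?thesis
  proof cases
    case 1
    have "((\<lambda>t. inverse t ^ n * exp (- inverse t)) has_real_derivative
        flat_fun (n + 2) t - real n * flat_fun (n + 1) t) (at t)"
      using 1 by (auto intro!: derivative_eq_intros simp: flat_fun_def power2_eq_square)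
        (cases n; simp add: algebra_simps)
    then show ?thesis
      by (rule has_field_derivative_transform_within_open[of _ _ _ "{0<..}"])
        (use 1 in \<open>auto simp: flat_fun_def\<close>)
  next
    case 2
    have "((\<lambda>t. 0) has_real_derivative flat_fun (n + 2) t - real n * flat_fun (n + 1) t) (at t)"
      using 2 by (simp add: flat_fun_def)
    then show ?thesis
      by (rule has_field_derivative_transform_within_open[of _ _ _ "{..<0}"])
        (use 2 in \<open>auto simp: flat_fun_def\<close>)
  next
    case 3
    \<comment> \<open>At the origin the difference quotient is the next function of the family.\<close>
    have "((\<lambda>h. (flat_fun n (0 + h) - flat_fun n 0) / h) \<longlongrightarrow> 0) (at 0)"
      using flat_fun_tendsto_0[of "Suc n"]
      by (rule Lim_transform_eventually)
        (auto simp: flat_fun_def eventually_at_filter divide_inverse)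
    then show ?thesis
      using 3 by (simp add: DERIV_def flat_fun_def)
  qed
qed

lemma Ck_on_flat_fun: "Ck_on k UNIV (flat_fun n)"
proof (induction k arbitrary: n)
  case 0
  show ?case
    by (simp add: continuous_at_imp_continuous_on DERIV_isCont[OF flat_fun_has_derivative])
next
  case (Suc k)
  let ?f' = "\<lambda>t u. (flat_fun (n + 2) t + (- real n) * flat_fun (n + 1) t) * u"
  have "Ck_on k UNIV (\<lambda>t. ?f' t u)" for u
    by (intro Ck_on_bounded_linear[OF _ bounded_linear_mult_left]
        Ck_on_bounded_linear[OF _ bounded_linear_mult_right] Ck_on_add Suc) auto
  moreover have "(flat_fun n has_derivative ?f' t) (at t)" for t
    using flat_fun_has_derivative[of n t] by (simp add: has_field_derivative_def)
  ultimately show ?case by (intro Ck_on_Suc[where f' = ?f']) auto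
qed

definition bump :: "'a::euclidean_space \<Rightarrow> real \<Rightarrow> 'a \<Rightarrow> real" where
  "bump a r x = flat_fun 0 (r\<^sup>2 - (x - a) \<bullet> (x - a))"

lemma bump_center: "r > 0 \<Longrightarrow> bump a r a > 0"
  by (simp add: bump_def flat_fun_def)

lemma bump_outside:
  assumes "r > 0" "x \<notin> cball a r"
  shows "bump a r x = 0"
proof -
  have "r < norm (x - a)"
    using assms by (simp add: dist_norm norm_minus_commute)
  then have "r\<^sup>2 < (norm (x - a))\<^sup>2"
    using assms(1) by (simp add: power_strict_mono)
  then show ?thesis by (simp add: bump_def flat_fun_def dot_square_norm)
qed

lemma smooth_on_bump:
  assumes "open S"
  shows "smooth_on S (bump a r)"
proof -
  have "Ck_on k UNIV (flat_fun 0 \<circ> (\<lambda>x::'a. r\<^sup>2 + - ((x + - a) \<bullet> (x + - a))))" for k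
    by (intro Ck_on_compose[OF _ open_UNIV] Ck_on_flat_fun Ck_on_add Ck_on_const Ck_on_id
        Ck_on_bounded_linear[OF _ bounded_linear_minus[OF bounded_linear_ident]]
        Ck_on_bounded_bilinear[OF _ bounded_bilinear_inner]) auto
  then show ?thesis
    using Ck_on_subset unfolding smooth_on_def bump_def o_def by fastforce
qed

section \<open>Local constructions on a manifold\<close>

lemma smooth_atlasD:
  assumes "smooth_atlas A" "(U, \<phi>) \<in> A"
  shows "open U" "open (\<phi> ` U)" "homeomorphism U (\<phi> ` U) \<phi> (inv_into U \<phi>)"
    "\<And>q. q \<in> U \<Longrightarrow> inv_into U \<phi> (\<phi> q) = q"
  using assms unfolding smooth_atlas_def by (auto simp: homeomorphism_def)

lemma smooth_transition:
  assumes "smooth_atlas A" "(U, \<phi>) \<in> A" "(V, \<psi>) \<in> A"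
  shows "smooth_on (\<phi> ` (U \<inter> V)) (\<psi> \<circ> inv_into U \<phi>)"
  using assms unfolding smooth_atlas_def by fast

lemma open_chart_image:
  assumes "smooth_atlas A" "(U, \<phi>) \<in> A" "open W"
  shows "open (\<phi> ` (U \<inter> W))"
proof -
  have "openin (top_of_set (\<phi> ` U)) (\<phi> ` (U \<inter> W))"
    using homeomorphism_imp_open_map[OF smooth_atlasD(3)[OF assms(1,2)]] assms(3)
    by (simp add: openin_open_Int)
  then show ?thesis
    using openin_open_trans smooth_atlasD(2)[OF assms(1,2)] by blast
qed

lemma smooth_fun_chart:
  assumes "smooth_fun A f" "(U, \<phi>) \<in> A"
  shows "smooth_on (\<phi> ` U) (f \<circ> inv_into U \<phi>)"
  using assms unfolding smooth_fun_def by blast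

lemma smooth_fun_add:
  assumes "smooth_atlas A" "smooth_fun A f" "smooth_fun A g"
  shows "smooth_fun A (f + g)"
proof -
  have "smooth_on (\<phi> ` U) ((f + g) \<circ> inv_into U \<phi>)" if c: "(U, \<phi>) \<in> A" for U \<phi>
    using smooth_on_add[OF smooth_atlasD(2)[OF assms(1) c] smooth_fun_chart[OF assms(2) c]
        smooth_fun_chart[OF assms(3) c]]
    by (simp add: o_def)
  then show ?thesis unfolding smooth_fun_def by blast
qed

lemma smooth_fun_mult:
  assumes "smooth_atlas A" "smooth_fun A f" "smooth_fun A g"
  shows "smooth_fun A (f * g)"
proof -
  have "smooth_on (\<phi> ` U) ((f * g) \<circ> inv_into U \<phi>)" if c: "(U, \<phi>) \<in> A" for U \<phi>
    using smooth_on_mult[OF smooth_atlasD(2)[OF assms(1) c] smooth_fun_chart[OF assms(2) c]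
        smooth_fun_chart[OF assms(3) c]]
    by (simp add: o_def)
  then show ?thesis unfolding smooth_fun_def by blast
qed

lemma smooth_fun_cmult:
  assumes "smooth_atlas A" "smooth_fun A f"
  shows "smooth_fun A (\<lambda>q. c * f q)"
proof -
  have "smooth_on (\<phi> ` U) ((\<lambda>q. c * f q) \<circ> inv_into U \<phi>)" if c': "(U, \<phi>) \<in> A" for U \<phi>
    using smooth_on_mult[OF smooth_atlasD(2)[OF assms(1) c'] smooth_on_const smooth_fun_chart[OF assms(2) c']]
      smooth_atlasD(2)[OF assms(1) c']
    by (simp add: o_def)
  then show ?thesis unfolding smooth_fun_def by blast
qed

text \<open>The support of the extended function is the preimage of a compact set, hence compact, hence
  closed because the manifold is Hausdorff. So the manifold is covered by two open sets, the chart
  domain and the complement of the support, and the extension is visibly smooth on each.\<close>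

lemma smooth_fun_extend_by_zero:
  fixes A :: "('m::{t2_space,second_countable_topology}, 'e::euclidean_space) atlas"
  assumes "smooth_atlas A" "(U, \<phi>) \<in> A" "smooth_on (\<phi> ` U) \<eta>"
    and "compact K" "K \<subseteq> \<phi> ` U" "\<And>x. x \<in> \<phi> ` U - K \<Longrightarrow> \<eta> x = 0"
  shows "smooth_fun A (\<lambda>q. if q \<in> U then \<eta> (\<phi> q) else 0)"
proof -
  let ?f = "\<lambda>q. if q \<in> U then \<eta> (\<phi> q) else 0"
  have "smooth_on (\<psi> ` V) (?f \<circ> inv_into V \<psi>)" if V: "(V, \<psi>) \<in> A" for V \<psi>
  proof -
    define C where "C = inv_into U \<phi> ` K"
    have "compact C"
      unfolding C_def using smooth_atlasD(3)[OF assms(1,2)] assms(4,5)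
      by (metis compact_continuous_image continuous_on_subset homeomorphism_def)
    then have opC: "open (- C)"
      using compact_imp_closed by blast
    note inv = smooth_atlasD(4)[OF assms(1) V]
    have op: "open (\<psi> ` (V \<inter> U))" "open (\<psi> ` (V \<inter> - C))"
      using open_chart_image[OF assms(1) V] smooth_atlasD(1)[OF assms(1,2)] opC by blast+
    have "smooth_on (\<psi> ` (V \<inter> U)) (\<eta> \<circ> (\<phi> \<circ> inv_into V \<psi>))"
    proof (rule smooth_on_compose[OF op(1) smooth_atlasD(2)[OF assms(1,2)]])
      show "(\<phi> \<circ> inv_into V \<psi>) ` \<psi> ` (V \<inter> U) \<subseteq> \<phi> ` U"
        using inv by auto
    qed (use smooth_transition[OF assms(1) V assms(2)] assms(3) in auto)
    then have "smooth_on (\<psi> ` (V \<inter> U)) (?f \<circ> inv_into V \<psi>)"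
      by (rule smooth_on_cong[OF op(1), rotated]) (use inv in auto)
    moreover have "smooth_on (\<psi> ` (V \<inter> - C)) (?f \<circ> inv_into V \<psi>)"
    proof (rule smooth_on_cong[OF op(2), rotated])
      show "smooth_on (\<psi> ` (V \<inter> - C)) (\<lambda>x. 0)"
        by (rule smooth_on_const[OF op(2)])
      show "0 = (?f \<circ> inv_into V \<psi>) y" if y: "y \<in> \<psi> ` (V \<inter> - C)" for y
      proof -
        obtain q where q: "q \<in> V" "q \<notin> C" "y = \<psi> q"
          using y by auto
        have "\<phi> q \<notin> K" if "q \<in> U"
          using q(2) smooth_atlasD(4)[OF assms(1,2) that] unfolding C_def by force
        then show ?thesis
          using q inv assms(6) by auto
      qed
    qed
    ultimately have "smooth_on (\<psi> ` (V \<inter> U) \<union> \<psi> ` (V \<inter> - C)) (?f \<circ> inv_into V \<psi>)"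
      using Ck_on_Un[OF op] unfolding smooth_on_def by blast
    moreover have "\<psi> ` V = \<psi> ` (V \<inter> U) \<union> \<psi> ` (V \<inter> - C)"
    proof -
      have "C \<subseteq> U"
        unfolding C_def using assms(5) by (auto intro: inv_into_into)
      then show ?thesis by blast
    qed
    ultimately show ?thesis by simp
  qed
  then show ?thesis unfolding smooth_fun_def by blast
qed

text \<open>The constant coordinate field in direction \<^term>\<open>u\<close>, multiplied by the cutoff
  \<^term>\<open>\<eta>\<close> and continued by zero outside the chart. Functions that are not smooth go to zero
  because tangent vectors are normalised in this way.\<close>

definition chart_field ::
    "('m, 'e::euclidean_space) atlas \<Rightarrow> 'm set \<Rightarrow> ('m \<Rightarrow> 'e) \<Rightarrow> ('e \<Rightarrow> real) \<Rightarrow> 'e \<Rightarrow> 'm vfield" where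
  "chart_field A U \<phi> \<eta> u = (\<lambda>q f. if q \<in> U \<and> smooth_fun A f
     then \<eta> (\<phi> q) * frechet_derivative (f \<circ> inv_into U \<phi>) (at (\<phi> q)) u else 0)"

lemma chart_field_tangent:
  assumes "smooth_atlas A" "(U, \<phi>) \<in> A"
  shows "chart_field A U \<phi> \<eta> u q \<in> tangent_space A q"
proof (cases "q \<in> U")
  case True
  let ?F = "\<lambda>f. frechet_derivative (f \<circ> inv_into U \<phi>) (at (\<phi> q))"
  have d: "(f \<circ> inv_into U \<phi> has_derivative ?F f) (at (\<phi> q))" if "smooth_fun A f" for f
    using smooth_on_differentiable[OF smooth_fun_chart[OF that assms(2)]] True by blast
  have "?F (f + g) u = ?F f u + ?F g u" if "smooth_fun A f" "smooth_fun A g" for f g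
  proof -
    have "((f + g) \<circ> inv_into U \<phi> has_derivative (\<lambda>u. ?F f u + ?F g u)) (at (\<phi> q))"
      using has_derivative_add[OF d[OF that(1)] d[OF that(2)]] by (simp add: o_def)
    then show ?thesis by (simp add: frechet_derivative_at[symmetric])
  qed
  moreover have "?F (f * g) u = ?F f u * g q + f q * ?F g u"
    if "smooth_fun A f" "smooth_fun A g" for f g
  proof -
    have "((f * g) \<circ> inv_into U \<phi> has_derivative (\<lambda>u. f q * ?F g u + ?F f u * g q)) (at (\<phi> q))"
      using has_derivative_mult[OF d[OF that(1)] d[OF that(2)]]
        smooth_atlasD(4)[OF assms True] by (simp add: o_def)
    then show ?thesis by (simp add: frechet_derivative_at[symmetric])
  qed
  moreover have "?F (\<lambda>q. c * f q) u = c * ?F f u" if "smooth_fun A f" for f c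
  proof -
    have "((\<lambda>q. c * f q) \<circ> inv_into U \<phi> has_derivative (\<lambda>u. c * ?F f u)) (at (\<phi> q))"
      using has_derivative_mult_right[OF d[OF that]] by (simp add: o_def)
    then show ?thesis by (simp add: frechet_derivative_at[symmetric])
  qed
  ultimately show ?thesis
    using True unfolding tangent_space_def chart_field_def
    by (simp add: smooth_fun_add smooth_fun_mult smooth_fun_cmult assms(1) algebra_simps)
qed (simp add: tangent_space_def chart_field_def)

lemma chart_field_vector_field:
  fixes A :: "('m::{t2_space,second_countable_topology}, 'e::euclidean_space) atlas"
  assumes "smooth_atlas A" "(U, \<phi>) \<in> A" "smooth_on (\<phi> ` U) \<eta>"
    and "compact K" "K \<subseteq> \<phi> ` U" "\<And>x. x \<in> \<phi> ` U - K \<Longrightarrow> \<eta> x = 0"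
  shows "chart_field A U \<phi> \<eta> u \<in> vector_fields A"
proof -
  have "smooth_fun A (vf_apply (chart_field A U \<phi> \<eta> u) f)" if f: "smooth_fun A f" for f
  proof -
    let ?h = "\<lambda>x. \<eta> x * frechet_derivative (f \<circ> inv_into U \<phi>) (at x) u"
    have "smooth_fun A (\<lambda>q. if q \<in> U then ?h (\<phi> q) else 0)"
      using assms(6) by (intro smooth_fun_extend_by_zero[OF assms(1,2) _ assms(4,5)]
        smooth_on_mult[OF smooth_atlasD(2)[OF assms(1,2)] assms(3)]
        smooth_on_derivative[OF smooth_fun_chart[OF f assms(2)]]) auto
    then show ?thesis
      using f by (simp add: vf_apply_def chart_field_def if_distrib cong: if_cong)
  qed
  then show ?thesis
    using chart_field_tangent[OF assms(1,2)] by (simp add: vector_fields_def)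
qed


section \<open>Tangent vectors extend to vector fields\<close>

interpretation tvec: vector_space scale_tvec
  by unfold_locales (auto simp: scale_tvec_def fun_eq_iff algebra_simps)

lemma sum_tvec_apply: "(\<Sum>i\<in>I. v i) f = (\<Sum>i\<in>I. v i f)" for v :: "'i \<Rightarrow> 'm tvec"
  by (induction I rule: infinite_finite_induct) auto

text \<open>The field is tested on the linear coordinate that pairs with \<^term>\<open>u\<close> itself, centred at the
  point and multiplied by the cutoff to make it global. Since it vanishes at the point, the
  derivative of the cutoff does not contribute, and the result is a multiple of the square of the
  norm of \<^term>\<open>u\<close>.\<close>

lemma chart_field_value_eq_0:
  fixes A :: "('m::{t2_space,second_countable_topology}, 'e::euclidean_space) atlas"
  assumes A: "smooth_atlas A" "(U, \<phi>) \<in> A" and \<eta>: "smooth_on (\<phi> ` U) \<eta>"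
    and K: "compact K" "K \<subseteq> \<phi> ` U" "\<And>x. x \<in> \<phi> ` U - K \<Longrightarrow> \<eta> x = 0"
    and p: "p \<in> U" "\<eta> (\<phi> p) \<noteq> 0"
    and zero: "chart_field A U \<phi> \<eta> u p = 0"
  shows "u = 0"
proof -
  note opU = smooth_atlasD(2)[OF A]
  let ?t = "\<lambda>x. \<eta> x * ((x + - \<phi> p) \<bullet> u)"
  define f where "f = (\<lambda>q. if q \<in> U then ?t (\<phi> q) else 0)"
  have "smooth_on (\<phi> ` U) (\<lambda>x. (x + - \<phi> p) \<bullet> u)"
    unfolding smooth_on_def
    by (intro allI Ck_on_bounded_linear[OF opU bounded_linear_inner_left] Ck_on_add[OF opU]
        Ck_on_id[OF opU] Ck_on_const[OF opU])
  then have f: "smooth_fun A f"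
    unfolding f_def using K(3)
    by (intro smooth_fun_extend_by_zero[OF A _ K(1,2)] smooth_on_mult[OF opU \<eta>]) auto
  obtain \<eta>' where \<eta>': "(\<eta> has_derivative \<eta>') (at (\<phi> p))"
    using smooth_on_differentiable[OF \<eta>] p(1) by blast
  have "(?t has_derivative (\<lambda>w. \<eta> (\<phi> p) * (w \<bullet> u))) (at (\<phi> p))"
    by (rule derivative_eq_intros \<eta>' refl | simp)+
  then have "(f \<circ> inv_into U \<phi> has_derivative (\<lambda>w. \<eta> (\<phi> p) * (w \<bullet> u))) (at (\<phi> p))"
    by (rule has_derivative_transform_within_open[OF _ opU])
      (use p(1) smooth_atlasD(4)[OF A] in \<open>auto simp: f_def\<close>)
  then have "chart_field A U \<phi> \<eta> u p f = \<eta> (\<phi> p) * (\<eta> (\<phi> p) * (u \<bullet> u))"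
    using p(1) f by (simp add: chart_field_def frechet_derivative_at[symmetric])
  then show ?thesis
    using zero p(2) by simp
qed

text \<open>The coordinate fields of a chart, cut off by a bump function, take linearly independent values
  at the centre. If the tangent space has at most the dimension of the model space, these values
  therefore span it, and the given vector is the value of one cut-off coordinate field.\<close>

lemma tangent_vector_extends:
  fixes A :: "('m::{t2_space,second_countable_topology}, 'e::euclidean_space) atlas"
  assumes A: "smooth_atlas A"
    and E: "finite E" "card E \<le> DIM('e)" "tangent_space A p \<subseteq> tvec.span E"
    and v: "v \<in> tangent_space A p"
  shows "\<exists>X\<in>vector_fields A. X p = v"
proof -
  have "p \<in> (\<Union>(U, \<phi>)\<in>A. U)"
    using A by (simp add: smooth_atlas_def)
  then obtain U \<phi> where U: "(U, \<phi>) \<in> A" and p: "p \<in> U"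
    by auto
  note opU = smooth_atlasD(2)[OF A U]
  obtain r where r: "r > 0" "cball (\<phi> p) r \<subseteq> \<phi> ` U"
    using opU p open_contains_cball by blast
  define \<eta> where "\<eta> = bump (\<phi> p) r"
  have \<eta>: "smooth_on (\<phi> ` U) \<eta>" "\<And>x. x \<in> \<phi> ` U - cball (\<phi> p) r \<Longrightarrow> \<eta> x = 0" "\<eta> (\<phi> p) \<noteq> 0"
    unfolding \<eta>_def using smooth_on_bump[OF opU] bump_outside[OF r(1)] bump_center[OF r(1), of "\<phi> p"]
    by auto
  define L where "L u = chart_field A U \<phi> \<eta> u p" for u
  have field: "chart_field A U \<phi> \<eta> u \<in> vector_fields A" for u
    by (rule chart_field_vector_field[OF A U \<eta>(1) compact_cball r(2) \<eta>(2)])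
  have L_tangent: "L u \<in> tangent_space A p" for u
    unfolding L_def by (rule chart_field_tangent[OF A U])
  have L_sum: "L (\<Sum>b\<in>Basis. c b *\<^sub>R b) = (\<Sum>b\<in>Basis. scale_tvec (c b) (L b))" for c
  proof
    fix f
    have "linear (frechet_derivative (f \<circ> inv_into U \<phi>) (at (\<phi> p)))" if "smooth_fun A f"
      using smooth_on_differentiable[OF smooth_fun_chart[OF that U]] p has_derivative_linear by blast
    then show "L (\<Sum>b\<in>Basis. c b *\<^sub>R b) f = (\<Sum>b\<in>Basis. scale_tvec (c b) (L b)) f"
      by (auto simp: L_def chart_field_def sum_tvec_apply scale_tvec_def linear_sum linear_cmul
          sum_distrib_left algebra_simps intro!: sum.cong)
  qed
  have kernel: "c b = 0" if "(\<Sum>b\<in>Basis. scale_tvec (c b) (L b)) = 0" "b \<in> Basis" for c b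
  proof -
    have "L (\<Sum>b\<in>Basis. c b *\<^sub>R b) = 0"
      using that(1) L_sum[of c] by simp
    then have zero: "chart_field A U \<phi> \<eta> (\<Sum>b\<in>Basis. c b *\<^sub>R b) p = 0"
      unfolding L_def .
    have "(\<Sum>b\<in>Basis. c b *\<^sub>R b) = 0"
      by (rule chart_field_value_eq_0[OF A U \<eta>(1) compact_cball r(2) _ p \<eta>(3) zero])
        (rule \<eta>(2))
    then show ?thesis
      using inner_sum_left_Basis[OF that(2), of c] by simp
  qed
  have inj: "inj_on L Basis"
  proof (rule inj_onI, rule ccontr)
    fix b b' :: 'e assume b: "b \<in> Basis" "b' \<in> Basis" "L b = L b'" "b \<noteq> b'"
    let ?c = "\<lambda>x. if x = b then 1 else if x = b' then - 1 else (0::real)"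
    have "(\<Sum>x\<in>Basis. scale_tvec (?c x) (L x)) = (\<Sum>x\<in>{b, b'}. scale_tvec (?c x) (L x))"
      using b by (intro sum.mono_neutral_right) auto
    also have "\<dots> = 0" using b by simp
    finally show False using kernel[OF _ b(1), of ?c] by simp
  qed
  have sum_image: "(\<Sum>w\<in>L ` Basis. scale_tvec (c w) w) = (\<Sum>b\<in>Basis. scale_tvec (c (L b)) (L b))" for c
    by (simp add: sum.reindex[OF inj])
  have indep: "tvec.independent (L ` Basis)"
    by (rule tvec.independent_if_scalars_zero) (use kernel sum_image in auto)
  have "v \<in> tvec.span (L ` Basis)"
  proof (rule ccontr)
    assume v': "v \<notin> tvec.span (L ` Basis)"
    then have "v \<notin> L ` Basis"
      by (auto intro: tvec.span_base)
    then have "card (insert v (L ` Basis)) = DIM('e) + 1"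
      by (simp add: card_image[OF inj])
    moreover have "tvec.independent (insert v (L ` Basis))"
      using v' indep by (simp add: tvec.independent_insertI)
    moreover have "insert v (L ` Basis) \<subseteq> tvec.span E"
      using E(3) v L_tangent by auto
    ultimately show False
      using tvec.independent_span_bound[OF E(1)] E(2) by fastforce
  qed
  then obtain c where "v = (\<Sum>w\<in>L ` Basis. scale_tvec (c w) w)"
    by (auto simp: tvec.span_finite)
  then have "v = L (\<Sum>b\<in>Basis. c (L b) *\<^sub>R b)"
    using L_sum[of "\<lambda>b. c (L b)"] sum_image by simp
  then show ?thesis
    using field unfolding L_def by blast
qed

section \<open>Conjugate connections on an anti-Hermitian manifold\<close>

lemma tangent_space_diff:
  assumes "v \<in> tangent_space A p" "w \<in> tangent_space A p"
  shows "v - w \<in> tangent_space A p"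
  using assms by (auto simp: tangent_space_def algebra_simps)

lemma vector_fieldsD: "X \<in> vector_fields A \<Longrightarrow> X p \<in> tangent_space A p"
  by (simp add: vector_fields_def)

lemma vf_apply_uminus:
  assumes "X \<in> vector_fields A" "smooth_fun A f"
  shows "vf_apply X (- f) = - vf_apply X f"
proof
  fix p
  have "X p (\<lambda>q. (- 1) * f q) = (- 1) * X p f"
    using vector_fieldsD[OF assms(1)] assms(2) unfolding tangent_space_def by blast
  moreover have "- f = (\<lambda>q. (- 1) * f q)" by (simp add: fun_eq_iff)
  ultimately show "vf_apply X (- f) p = (- vf_apply X f) p"
    by (simp add: vf_apply_def)
qed

lemma metric_diff:
  assumes h: "pseudo_riemannian_metric A h"
    and "u \<in> tangent_space A p" "v \<in> tangent_space A p" "w \<in> tangent_space A p"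
  shows "h p (u - v) w = h p u w - h p v w"
proof -
  have add: "\<forall>u\<in>tangent_space A p. \<forall>v\<in>tangent_space A p. \<forall>w\<in>tangent_space A p.
      h p (u + v) w = h p u w + h p v w"
    using h by (simp add: pseudo_riemannian_metric_def)
  have "h p (u - v + v) w = h p (u - v) w + h p v w"
    by (rule add[rule_format, OF tangent_space_diff[OF assms(2,3)] assms(3,4)])
  then show ?thesis by simp
qed

lemma bilin_app_sym:
  assumes "pseudo_riemannian_metric A h" "X \<in> vector_fields A" "Y \<in> vector_fields A"
  shows "bilin_app h X Y = bilin_app h Y X"
  using assms by (simp add: pseudo_riemannian_metric_def bilin_app_def vector_fieldsD)

lemma signature_spans:
  assumes "signature_at A h p r s"
  shows "\<exists>E. finite E \<and> card E \<le> r + s \<and> tangent_space A p \<subseteq> tvec.span E"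
proof -
  obtain e where e: "\<And>v. v \<in> tangent_space A p \<Longrightarrow> \<exists>c. v = (\<Sum>i<r + s. scale_tvec (c i) (e i))"
    using assms unfolding signature_at_def by blast
  have "v \<in> tvec.span (e ` {..<r + s})" if v: "v \<in> tangent_space A p" for v
  proof -
    obtain c where c: "v = (\<Sum>i<r + s. scale_tvec (c i) (e i))"
      using e[OF v] by blast
    show ?thesis
      unfolding c by (rule tvec.span_sum, rule tvec.span_scale, rule tvec.span_base) simp
  qed
  moreover have "card (e ` {..<r + s}) \<le> r + s"
    using card_image_le[of "{..<r + s}" e] by simp
  ultimately show ?thesis by blast
qed

locale anti_hermitian_manifold =
  fixes n :: nat
    and A :: "('m::{t2_space,second_countable_topology}, 'e::euclidean_space) atlas"
    and J :: "'m endo_field" and g G :: "'m bilin_field"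
  assumes anti_hermitian: "almost_anti_hermitian n A J g G"
begin

lemma metric: "pseudo_riemannian_metric A g"
  using anti_hermitian by (simp add: almost_anti_hermitian_def)

lemma J_field [intro]: "X \<in> vector_fields A \<Longrightarrow> endo_app J X \<in> vector_fields A"
  using anti_hermitian by (simp add: almost_anti_hermitian_def almost_complex_structure_def)

lemma g_smooth:
  "X \<in> vector_fields A \<Longrightarrow> Y \<in> vector_fields A \<Longrightarrow> smooth_fun A (bilin_app g X Y)"
  using metric by (simp add: pseudo_riemannian_metric_def)

lemma g_J_J:
  "X \<in> vector_fields A \<Longrightarrow> Y \<in> vector_fields A \<Longrightarrow>
    bilin_app g (endo_app J X) (endo_app J Y) = - bilin_app g X Y"
  using anti_hermitian by (simp add: almost_anti_hermitian_def)

lemma twin: "bilin_app G X Y = bilin_app g (endo_app J X) Y"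
  using anti_hermitian
  by (simp add: almost_anti_hermitian_def twin_metric_def bilin_app_def endo_app_def)

lemma g_JJ:
  assumes "X \<in> vector_fields A" "Y \<in> vector_fields A"
  shows "bilin_app g (endo_app J (endo_app J X)) Y = - bilin_app g X Y"
proof
  fix p
  have "J p (J p (X p)) = scale_tvec (- 1) (X p)"
    using anti_hermitian vector_fieldsD[OF assms(1)]
    by (simp add: almost_anti_hermitian_def almost_complex_structure_def)
  moreover have "g p (scale_tvec c (X p)) (Y p) = c * g p (X p) (Y p)" for c
    using metric assms by (simp add: pseudo_riemannian_metric_def vector_fieldsD)
  ultimately show "bilin_app g (endo_app J (endo_app J X)) Y p = (- bilin_app g X Y) p"
    by (simp add: bilin_app_def endo_app_def del: tvec.scale_minus_left)
qed

lemma g_J_swap: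
  assumes "X \<in> vector_fields A" "Y \<in> vector_fields A"
  shows "bilin_app g (endo_app J X) Y = bilin_app g X (endo_app J Y)"
  using g_J_J[OF J_field[OF assms(1)] assms(2)] g_JJ[OF assms(1) J_field[OF assms(2)]]
  by simp

text \<open>Nondegeneracy of the metric speaks of all tangent vectors, so it applies to a tangent vector
  that is orthogonal to all vector fields only because every tangent vector extends to a field.
  The neutral signature supplies the bound on the dimension of the tangent space.\<close>

lemma orthogonal_to_fields_eq_0:
  assumes w: "w \<in> tangent_space A p" and orth: "\<And>X. X \<in> vector_fields A \<Longrightarrow> g p w (X p) = 0"
  shows "w = 0"
proof -
  have "smooth_atlas A" "DIM('e) = n + n" "signature_at A g p n n"
    using anti_hermitian by (simp_all add: almost_anti_hermitian_def)
  then have "g p w v = 0" if "v \<in> tangent_space A p" for v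
    using signature_spans[of A g p n n] tangent_vector_extends[of A _ p v] that orth by metis
  then show ?thesis
    using metric w unfolding pseudo_riemannian_metric_def by blast
qed

text \<open>In every term of the derivative, \<^term>\<open>J\<close> can be moved through \<^term>\<open>D\<close>. It can also be moved
  from one argument of \<^term>\<open>g\<close> to the other, which gives the first equation, and removed from
  both at the price of a sign, which gives the second.\<close>

lemma cov_deriv_twin:
  assumes D: "linear_connection A D" "J_invariant A J D"
    and X: "X \<in> vector_fields A" and Y: "Y \<in> vector_fields A" and Z: "Z \<in> vector_fields A"
  shows "cov_deriv_metric D G Z X Y = cov_deriv_metric D g Z X (endo_app J Y)" (is ?swap)
    and "cov_deriv_metric D G Z X (endo_app J Y) = - cov_deriv_metric D g Z X Y" (is ?neg)
proof -
  have fields: "D Z X \<in> vector_fields A" "D Z Y \<in> vector_fields A"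
    and DJ: "D Z (endo_app J Y) = endo_app J (D Z Y)"
    using D X Y Z by (auto simp: linear_connection_def J_invariant_def)
  show ?swap
    by (simp add: cov_deriv_metric_def twin g_J_swap X Y fields DJ)
  show ?neg
    by (simp add: cov_deriv_metric_def twin g_J_J X Y fields DJ
        vf_apply_uminus[OF Z g_smooth])
qed

lemma codazzi_twin_iff:
  assumes "linear_connection A D" "J_invariant A J D"
  shows "codazzi_pair A D G \<longleftrightarrow> codazzi_pair A D g"
proof
  assume G: "codazzi_pair A D G"
  have "cov_deriv_metric D g Z X Y = cov_deriv_metric D g X Z Y"
    if "X \<in> vector_fields A" "Y \<in> vector_fields A" "Z \<in> vector_fields A" for X Y Z
  proof -
    have "cov_deriv_metric D G Z X (endo_app J Y) = cov_deriv_metric D G X Z (endo_app J Y)"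
      using G that J_field unfolding codazzi_pair_def by blast
    then show ?thesis
      using that by (simp add: cov_deriv_twin(2)[OF assms])
  qed
  then show "codazzi_pair A D g" by (simp add: codazzi_pair_def)
next
  assume g: "codazzi_pair A D g"
  then have "cov_deriv_metric D g Z X (endo_app J Y) = cov_deriv_metric D g X Z (endo_app J Y)"
    if "X \<in> vector_fields A" "Y \<in> vector_fields A" "Z \<in> vector_fields A" for X Y Z
    using that J_field unfolding codazzi_pair_def by blast
  then show "codazzi_pair A D G"
    by (simp add: codazzi_pair_def cov_deriv_twin(1)[OF assms])
qed

text \<open>Put \<^term>\<open>endo_app J X\<close> for \<^term>\<open>X\<close> in the equation that defines the conjugate with
  respect to the twin metric: as \<^term>\<open>D\<close> commutes with \<^term>\<open>J\<close>, each of its terms turns into the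
  negative of the corresponding term for \<^term>\<open>g\<close>.\<close>

lemma conjugate_twin_imp_conjugate:
  assumes D: "linear_connection A D" "J_invariant A J D" and conj: "conjugate_connection A G D D'"
  shows "conjugate_connection A g D D'"
proof -
  have "vf_apply Z (bilin_app g X Y) = bilin_app g (D Z X) Y + bilin_app g X (D' Z Y)"
    if X: "X \<in> vector_fields A" and Y: "Y \<in> vector_fields A" and Z: "Z \<in> vector_fields A" for X Y Z
  proof -
    have fields: "D Z X \<in> vector_fields A" "D' Z Y \<in> vector_fields A"
      and DJ: "D Z (endo_app J X) = endo_app J (D Z X)"
      using D conj X Y Z
      by (auto simp: linear_connection_def J_invariant_def conjugate_connection_def)
    have "vf_apply Z (bilin_app G (endo_app J X) Y)
        = bilin_app G (D Z (endo_app J X)) Y + bilin_app G (endo_app J X) (D' Z Y)"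
      using conj X Y Z J_field unfolding conjugate_connection_def by blast
    then have "- vf_apply Z (bilin_app g X Y)
        = - bilin_app g (D Z X) Y + - bilin_app g X (D' Z Y)"
      by (simp add: twin DJ g_JJ X Y fields vf_apply_uminus[OF Z g_smooth])
    then show ?thesis
      by (simp add: fun_eq_iff) (smt (verit))
  qed
  then show ?thesis
    using conj by (simp add: conjugate_connection_def)
qed

text \<open>The covariant derivative of the metric measures the difference of a connection and its
  conjugate, so it changes sign when the two are exchanged.\<close>

lemma cov_deriv_eq_difference:
  assumes conj: "conjugate_connection A g D D'"
    and X: "X \<in> vector_fields A" and Y: "Y \<in> vector_fields A" and Z: "Z \<in> vector_fields A"
  shows "cov_deriv_metric D g Z X Y = bilin_app g X (D' Z Y) - bilin_app g X (D Z Y)"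
  using assms by (simp add: cov_deriv_metric_def conjugate_connection_def)

lemma cov_deriv_conjugate:
  assumes D: "linear_connection A D" and conj: "conjugate_connection A g D D'"
    and X: "X \<in> vector_fields A" and Y: "Y \<in> vector_fields A" and Z: "Z \<in> vector_fields A"
  shows "cov_deriv_metric D' g Z X Y = - cov_deriv_metric D g Z X Y"
proof -
  have fields: "D Z X \<in> vector_fields A" "D' Z X \<in> vector_fields A"
    "D Z Y \<in> vector_fields A" "D' Z Y \<in> vector_fields A"
    using D conj X Y Z by (auto simp: linear_connection_def conjugate_connection_def)
  have "vf_apply Z (bilin_app g Y X) = bilin_app g (D Z Y) X + bilin_app g Y (D' Z X)"
    using conj X Y Z by (simp add: conjugate_connection_def)
  then have "vf_apply Z (bilin_app g X Y) = bilin_app g X (D Z Y) + bilin_app g (D' Z X) Y"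
    by (simp only: bilin_app_sym[OF metric Y X] bilin_app_sym[OF metric Y fields(2)]
        bilin_app_sym[OF metric fields(3) X])
  then have "cov_deriv_metric D' g Z X Y = bilin_app g X (D Z Y) - bilin_app g X (D' Z Y)"
    by (simp add: cov_deriv_metric_def)
  then show ?thesis
    by (simp add: cov_deriv_eq_difference[OF conj X Y Z])
qed

lemma codazzi_conjugate_iff:
  assumes "linear_connection A D" "conjugate_connection A g D D'"
  shows "codazzi_pair A D' g \<longleftrightarrow> codazzi_pair A D g"
  unfolding codazzi_pair_def by (simp add: cov_deriv_conjugate[OF assms])

text \<open>A Codazzi pair has a totally symmetric covariant derivative of the metric. Read through
  the difference of the two connections, this symmetry says that the difference is a symmetric
  tensor, and so the conjugate has the same torsion.\<close>

lemma torsion_free_conjugate: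
  assumes D: "linear_connection A D" "torsion_free A D" "codazzi_pair A D g"
    and conj: "conjugate_connection A g D D'"
  shows "torsion_free A D'"
proof -
  have "D' X Y - D' Y X = lie_bracket X Y"
    if X: "X \<in> vector_fields A" and Y: "Y \<in> vector_fields A" for X Y
  proof
    fix p
    have fields: "D X Y \<in> vector_fields A" "D Y X \<in> vector_fields A"
      "D' X Y \<in> vector_fields A" "D' Y X \<in> vector_fields A"
      using D conj X Y by (auto simp: linear_connection_def conjugate_connection_def)
    note tangent = fields[THEN vector_fieldsD, of p]
    let ?w = "(D' X Y p - D' Y X p) - (D X Y p - D Y X p)"
    have w: "?w \<in> tangent_space A p"
      by (intro tangent_space_diff tangent)
    have "g p ?w (W p) = 0" if W: "W \<in> vector_fields A" for W
    proof -
      have sym: "cov_deriv_metric D g Z W' V = cov_deriv_metric D g Z V W'"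
        if "Z \<in> vector_fields A" "W' \<in> vector_fields A" "V \<in> vector_fields A" for Z W' V
        using that D(1) bilin_app_sym[OF metric]
        by (simp add: cov_deriv_metric_def linear_connection_def algebra_simps)
      have cod: "cov_deriv_metric D g Z V W' = cov_deriv_metric D g V Z W'"
        if "Z \<in> vector_fields A" "W' \<in> vector_fields A" "V \<in> vector_fields A" for Z W' V
        using D(3) that by (simp add: codazzi_pair_def)
      have "cov_deriv_metric D g X W Y = cov_deriv_metric D g Y W X"
        using sym[OF X W Y] cod[OF X W Y] sym[OF Y W X] by simp
      then have "bilin_app g W (D' X Y) - bilin_app g W (D X Y)
          = bilin_app g W (D' Y X) - bilin_app g W (D Y X)"
        by (simp add: cov_deriv_eq_difference[OF conj] X Y W)
      then have "bilin_app g (D' X Y) W - bilin_app g (D X Y) W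
          = bilin_app g (D' Y X) W - bilin_app g (D Y X) W"
        using fields[THEN bilin_app_sym[OF metric _ W]] by simp
      then have "g p (D' X Y p) (W p) - g p (D X Y p) (W p)
          = g p (D' Y X p) (W p) - g p (D Y X p) (W p)"
        by (auto simp: bilin_app_def dest: fun_cong[where x = p])
      then show ?thesis
        by (simp add: metric_diff[OF metric] tangent tangent_space_diff vector_fieldsD[OF W])
    qed
    then have "?w = 0" by (rule orthogonal_to_fields_eq_0[OF w])
    moreover have "D X Y - D Y X = lie_bracket X Y"
      using D(2) X Y unfolding torsion_free_def by blast
    then have "D X Y p - D Y X p = lie_bracket X Y p"
      by (auto dest: fun_cong[where x = p])
    ultimately show "(D' X Y - D' Y X) p = lie_bracket X Y p" by simp
  qed
  then show ?thesis by (simp add: torsion_free_def)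
qed

lemma statistical_conjugate_iff:
  assumes "linear_connection A D" "torsion_free A D" "conjugate_connection A g D D'"
  shows "statistical_structure A D' g \<longleftrightarrow> codazzi_pair A D g"
  using assms codazzi_conjugate_iff torsion_free_conjugate
  unfolding statistical_structure_def by blast

end

theorem theorem4:
  fixes A :: "('m::{t2_space,second_countable_topology}, 'e::euclidean_space) atlas"
    and n :: nat
    and J :: "'m endo_field"
    and g G :: "'m bilin_field"
    and D Ddag Dstar :: "'m connection"
  assumes "almost_anti_hermitian n A J g G"
    and "linear_connection A D"
    and "J_invariant A J D"
    and "torsion_free A D"
    and "conjugate_connection A G D Ddag"
    and "conjugate_connection A g D Dstar"
  shows "(statistical_structure A D G \<longrightarrow>
            statistical_structure A Ddag g \<and>
            statistical_structure A D g \<and>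
            statistical_structure A Dstar g) \<and>
         (statistical_structure A Ddag g \<or>
          statistical_structure A D g \<or>
          statistical_structure A Dstar g \<longrightarrow>
            statistical_structure A D G)"
proof -
  interpret anti_hermitian_manifold n A J g G
    by unfold_locales (rule assms(1))
  have "statistical_structure A D G \<longleftrightarrow> codazzi_pair A D g"
    "statistical_structure A D g \<longleftrightarrow> codazzi_pair A D g"
    using codazzi_twin_iff[OF assms(2,3)] assms(4) by (simp_all add: statistical_structure_def)
  moreover have "statistical_structure A Ddag g \<longleftrightarrow> codazzi_pair A D g"
    using statistical_conjugate_iff[OF assms(2,4)] conjugate_twin_imp_conjugate[OF assms(2,3,5)]
    by blast
  moreover have "statistical_structure A Dstar g \<longleftrightarrow> codazzi_pair A D g"
    by (rule statistical_conjugate_iff[OF assms(2,4,6)])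
  ultimately show ?thesis by blast
qed

end
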